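(* There exists a translation invariant site percolation $X$ on $\mathbb{Z}^2$ that satisfies finite energy and that produces, almost surely, an infinite open cluster and an infinite closed cluster.
   Context: A site percolation on $\mathbb{Z}^2$ is a $\{0,1\}^{\mathbb{Z}^2}$-valued random object $X$. It is translation invariant if for any $n$ and any $x_1,\ldots,x_n\in\mathbb{Z}^2$, the distribution of $(X(x_1+y),\ldots,X(x_n+y))$ does not depend on $y\in\mathbb{Z}^2$. Two vertices $x,y\in\mathbb{Z}^2$ communicate if there is a path $\{z_1,\ldots,z_n\}$ from $z_1=x$ to $z_n=y$, with consecutive vertices being $L_1$-nearest neighbors (at $L_1$-distance $1$), such that $X(z_1)=X(z_2)=\cdots=X(z_n)$. A connected component is a maximal set of vertices that all communicate with each other; it is called an open cluster if its vertices take value $1$ in $X$, and a closed cluster if its vertices take value $0$ in $X$. A site percolation $X$ on $\mathbb{Z}^2$ satisfies finite energy if it admits conditional probabilities such that for all $x\in\mathbb{Z}^2$ and all $\xi\in\{0,1\}^{\mathbb{Z}^2\setminus\{x\}}$ we have $$0<\mathbf{P}\big(X(x)=1\,\big|\,X(\mathbb{Z}^2\setminus\{x\})=\xi\big)<1 .$$ *)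

theory Defs
  imports "HOL-Probability.Probability"
begin

type_synonym site = "int \<times> int"

text \<open>Configurations take values in \<^typ>\<open>bool\<close>, with \<^const>\<open>True\<close> for the value 1 (open) and
  \<^const>\<open>False\<close> for the value 0 (closed). Elements of \<open>space (config_space V)\<close> are extensional,
  i.e. they take the value \<^const>\<open>undefined\<close> outside \<open>V\<close>.\<close>

type_synonym config = "site \<Rightarrow> bool"

definition config_space :: "site set \<Rightarrow> config measure" where
  "config_space V = PiM V (\<lambda>_. count_space (UNIV :: bool set))"

definition site_percolation :: "'a measure \<Rightarrow> ('a \<Rightarrow> config) \<Rightarrow> bool" where
  "site_percolation M X \<longleftrightarrow> prob_space M \<and> X \<in> measurable M (config_space UNIV)"

definition translation_invariant :: "'a measure \<Rightarrow> ('a \<Rightarrow> config) \<Rightarrow> bool" where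
  "translation_invariant M X \<longleftrightarrow>
     (\<forall>(n :: nat) (x :: nat \<Rightarrow> site) (y :: site) (y' :: site).
        distr M (PiM {1..n} (\<lambda>_. count_space (UNIV :: bool set)))
          (\<lambda>\<omega>. \<lambda>i\<in>{1..n}. X \<omega> (x i + y)) =
        distr M (PiM {1..n} (\<lambda>_. count_space (UNIV :: bool set)))
          (\<lambda>\<omega>. \<lambda>i\<in>{1..n}. X \<omega> (x i + y')))"

definition nearest_neighbors :: "site \<Rightarrow> site \<Rightarrow> bool" where
  "nearest_neighbors u v \<longleftrightarrow> \<bar>fst u - fst v\<bar> + \<bar>snd u - snd v\<bar> = 1"

definition communicate :: "config \<Rightarrow> site \<Rightarrow> site \<Rightarrow> bool" where
  "communicate \<omega> x y \<longleftrightarrow>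
     (\<exists>zs. zs \<noteq> [] \<and> hd zs = x \<and> last zs = y \<and> successively nearest_neighbors zs \<and>
           (\<forall>u\<in>set zs. \<forall>v\<in>set zs. \<omega> u = \<omega> v))"

definition mutually_communicating :: "config \<Rightarrow> site set \<Rightarrow> bool" where
  "mutually_communicating \<omega> C \<longleftrightarrow> (\<forall>x\<in>C. \<forall>y\<in>C. communicate \<omega> x y)"

definition connected_component_of_config :: "config \<Rightarrow> site set \<Rightarrow> bool" where
  "connected_component_of_config \<omega> C \<longleftrightarrow>
     mutually_communicating \<omega> C \<and>
     (\<forall>D. C \<subseteq> D \<and> mutually_communicating \<omega> D \<longrightarrow> D = C)"

definition open_cluster :: "config \<Rightarrow> site set \<Rightarrow> bool" where
  "open_cluster \<omega> C \<longleftrightarrow> connected_component_of_config \<omega> C \<and> (\<forall>x\<in>C. \<omega> x)"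

definition closed_cluster :: "config \<Rightarrow> site set \<Rightarrow> bool" where
  "closed_cluster \<omega> C \<longleftrightarrow> connected_component_of_config \<omega> C \<and> (\<forall>x\<in>C. \<not> \<omega> x)"

definition off_site :: "('a \<Rightarrow> config) \<Rightarrow> site \<Rightarrow> 'a \<Rightarrow> config" where
  "off_site X x \<omega> = restrict (X \<omega>) (- {x})"

text \<open>\<open>q \<xi>\<close> is a version of the conditional probability of \<open>X(x) = 1\<close> given that \<open>X\<close> agrees with
  \<open>\<xi>\<close> off \<open>x\<close>: a measurable function of \<open>\<xi>\<close> which, evaluated at the restriction of \<open>X\<close>, is
  almost surely the conditional expectation of the indicator of \<open>X(x) = 1\<close> given the sigma-algebra
  generated by that restriction.\<close>

definition cond_prob_version ::
    "'a measure \<Rightarrow> ('a \<Rightarrow> config) \<Rightarrow> site \<Rightarrow> (config \<Rightarrow> real) \<Rightarrow> bool" where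
  "cond_prob_version M X x q \<longleftrightarrow>
     q \<in> borel_measurable (config_space (- {x})) \<and>
     (AE \<omega> in M. q (off_site X x \<omega>) =
        real_cond_exp M (vimage_algebra (space M) (off_site X x) (config_space (- {x})))
          (indicator {\<omega> \<in> space M. X \<omega> x}) \<omega>)"

text \<open>The bounds hold for every \<open>\<xi>\<close>, not merely almost every one: it is the choice of version
  that is existentially quantified.\<close>

definition finite_energy :: "'a measure \<Rightarrow> ('a \<Rightarrow> config) \<Rightarrow> bool" where
  "finite_energy M X \<longleftrightarrow>
     (\<exists>q :: site \<Rightarrow> config \<Rightarrow> real. \<forall>x.
        cond_prob_version M X x (q x) \<and>
        (\<forall>\<xi>\<in>space (config_space (- {x})). 0 < q x \<xi> \<and> q x \<xi> < 1))"

end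

theory Submission
  imports Defs
begin

text \<open>The percolation is an equivariant function of independent labels on columns, rows and sites, and
  translation invariance follows, because the product measure is invariant under permutations of
  its coordinates (\<open>translation_invariant_woven_law\<close>).

  Columns and rows carry independent geometric labels. A label makes its own line open and the next
  line closed; of the two labels that a line sees, the larger one gives its colour and its level, and
  a site takes the colour of the line of higher level through it. From an open site one walks along
  the visible line, upwards on columns and to the right on rows, and from a closed site downwards
  and to the left. Such a walk changes lines only to lines of at least the same level, and the first
  such line in its way always has its own colour (\<open>colour_next_site\<close>). So there are
  infinite monochromatic paths of both colours.

  To obtain finite energy, sites are flipped by independent noise, and the noise must be so rare
  along the paths that they are broken only finitely often. A rate that is constant would not do: the
  noise probability has to be summable along the path, and yet be chosen in a stationary way. It is
  therefore governed by the depth of a site, which measures how far one has to look back to see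
  labels above its level. Such labels exist almost surely because the labels are unbounded in every
  direction, and the depth strictly increases along the paths because the level never drops and no
  line that is passed carries a label above it (\<open>depth_next_site\<close>). A site of depth \<open>k\<close> is flipped
  with probability \<open>(1 / 2) ^ Suc k\<close>, so by the Borel-Cantelli lemma a tail of each path is not
  flipped at all, and it lies in an infinite cluster (\<open>AE_woven_law_percolates\<close>).

  The noise at a site is independent of everything off that site and flips or preserves its colour
  with positive probability each. Therefore nothing off the site can force its value, and this is
  finite energy (\<open>finite_energy_if_both_values_possible\<close>).\<close>

section \<open>Weaving coloured lines\<close>

text \<open>Columns carry labels \<open>a\<close> and rows carry labels \<open>b\<close>. Each label is used twice: it makes its own
  line open and the following line closed, so a line sees two labels, and the larger one decides
  its colour and its level. The label that decides an open line is seen by the following line, too,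
  and the label that decides a closed line by the preceding one; hence these neighbours have at
  least the same level.\<close>

definition line_level :: "(int \<Rightarrow> nat) \<Rightarrow> int \<Rightarrow> nat" where
  "line_level a i = max (a (i - 1)) (a i)"

definition line_open :: "(int \<Rightarrow> nat) \<Rightarrow> int \<Rightarrow> bool" where
  "line_open a i \<longleftrightarrow> a (i - 1) < a i"

text \<open>The lines are woven like threads: at a crossing the line of higher level is visible.\<close>

definition column_on_top :: "(int \<Rightarrow> nat) \<Rightarrow> (int \<Rightarrow> nat) \<Rightarrow> site \<Rightarrow> bool" where
  "column_on_top a b v \<longleftrightarrow> line_level b (snd v) < line_level a (fst v)"

definition colour :: "(int \<Rightarrow> nat) \<Rightarrow> (int \<Rightarrow> nat) \<Rightarrow> site \<Rightarrow> bool" where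
  "colour a b v =
     (if column_on_top a b v then line_open a (fst v) else line_open b (snd v))"

definition level :: "(int \<Rightarrow> nat) \<Rightarrow> (int \<Rightarrow> nat) \<Rightarrow> site \<Rightarrow> nat" where
  "level a b v = max (line_level a (fst v)) (line_level b (snd v))"

definition direction :: "(int \<Rightarrow> nat) \<Rightarrow> (int \<Rightarrow> nat) \<Rightarrow> site \<Rightarrow> int" where
  "direction a b v = (if colour a b v then 1 else - 1)"

text \<open>From an open site, follow the visible line upwards or to the right; from a closed site, follow it
  downwards or to the left. The two colours go opposite ways because a label puts its open line
  before its closed line.\<close>

definition next_site :: "(int \<Rightarrow> nat) \<Rightarrow> (int \<Rightarrow> nat) \<Rightarrow> site \<Rightarrow> site" where
  "next_site a b v =
     (if column_on_top a b v then (fst v, snd v + direction a b v)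
      else (fst v + direction a b v, snd v))"

text \<open>Looking backwards, against the direction of travel, from a site: both a column and a row carry
  labels above the level of the site, at distances that add up to \<open>k\<close>.\<close>

definition surpassed_within :: "(int \<Rightarrow> nat) \<Rightarrow> (int \<Rightarrow> nat) \<Rightarrow> site \<Rightarrow> nat \<Rightarrow> bool" where
  "surpassed_within a b v k \<longleftrightarrow>
     (\<exists>p q. k = p + q \<and>
        level a b v < a (fst v - direction a b v * int p) \<and>
        level a b v < b (snd v - direction a b v * int q))"

definition depth :: "(int \<Rightarrow> nat) \<Rightarrow> (int \<Rightarrow> nat) \<Rightarrow> site \<Rightarrow> nat" where
  "depth a b v = (LEAST k. surpassed_within a b v k)"

definition unbounded_both_ways :: "(int \<Rightarrow> nat) \<Rightarrow> bool" where
  "unbounded_both_ways a \<longleftrightarrow>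
     (\<forall>i m. (\<exists>p::nat. m < a (i - int p)) \<and> (\<exists>p::nat. m < a (i + int p)))"

lemma nearest_neighbors_next_site: "nearest_neighbors v (next_site a b v)"
  by (simp add: nearest_neighbors_def next_site_def direction_def)

lemma level_le_next_site: "level a b v \<le> level a b (next_site a b v)"
  by (auto simp: level_def next_site_def column_on_top_def)

text \<open>While the same line stays on top nothing changes. Otherwise the line that crosses it at the new
  site is on top there, whereas the parallel line through the old site was not on top. If the line
  on top had the opposite colour, then the label deciding its level would also be seen by that
  parallel line, which would thus have been on top already.\<close>

lemma colour_next_site: "colour a b (next_site a b v) = colour a b v"
proof -
  obtain i j where v: "v = (i, j)" by fastforce
  show ?thesis
  proof (cases "column_on_top a b v")
    case True
    then have "line_level b j < line_level a i" by (simp add: column_on_top_def v)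
    then show ?thesis
      by (cases "line_open a i")
        (auto simp: v colour_def next_site_def direction_def column_on_top_def
          line_level_def line_open_def)
  next
    case False
    then have "line_level a i \<le> line_level b j" by (simp add: column_on_top_def v)
    then show ?thesis
      by (cases "line_open b j")
        (auto simp: v colour_def next_site_def direction_def column_on_top_def
          line_level_def line_open_def)
  qed
qed

lemma direction_next_site: "direction a b (next_site a b v) = direction a b v"
  by (simp add: direction_def colour_next_site)

lemma surpassed_within_depth:
  assumes "unbounded_both_ways a" "unbounded_both_ways b"
  shows "surpassed_within a b v (depth a b v)"
proof -
  have "\<exists>p::nat. level a b v < c (i - direction a b v * int p)" if "unbounded_both_ways c" for c i
    using that unfolding unbounded_both_ways_def direction_def by simp
  from this[OF assms(1)] this[OF assms(2)] obtain p q where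
    "level a b v < a (fst v - direction a b v * int p)"
    "level a b v < b (snd v - direction a b v * int q)" by meson
  then have "surpassed_within a b v (p + q)"
    unfolding surpassed_within_def by blast
  then have "\<exists>k. surpassed_within a b v k" ..
  then show ?thesis unfolding depth_def by (rule LeastI_ex)
qed

text \<open>The level grows weakly along a step, so labels above the new level are above the old one, too.
  None of them sits on a line through the new site, as these lines see only labels up to the level.
  Hence the coordinate that has moved is at distance at least one from its witness, and seen from
  the old site the sum of the two distances is smaller by one.\<close>

lemma depth_next_site:
  assumes "unbounded_both_ways a" "unbounded_both_ways b"
  shows "depth a b v < depth a b (next_site a b v)"
proof -
  let ?w = "next_site a b v" and ?s = "direction a b v"
  obtain p q where pq: "depth a b ?w = p + q"
      "level a b ?w < a (fst ?w - ?s * int p)" "level a b ?w < b (snd ?w - ?s * int q)"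
    using surpassed_within_depth[OF assms, of ?w]
    unfolding surpassed_within_def direction_next_site by blast
  have own: "a (fst ?w) \<le> level a b ?w" "b (snd ?w) \<le> level a b ?w"
    by (auto simp: level_def line_level_def)
  have le: "level a b v \<le> level a b ?w" by (rule level_le_next_site)
  have "surpassed_within a b v (p + q - 1) \<and> 0 < p + q"
  proof (cases "column_on_top a b v")
    case True
    \<comment> \<open>The row through the new site cannot be the witness, and it is the row that has changed.\<close>
    from pq(3) own(2) have "q \<noteq> 0" by (intro notI) simp
    then obtain q' where q': "q = Suc q'" by (cases q) auto
    have "level a b v < b (snd v - ?s * int q')"
      using pq(3) le True by (simp add: next_site_def q' algebra_simps)
    moreover have "level a b v < a (fst v - ?s * int p)"
      using pq(2) le True by (simp add: next_site_def)
    ultimately show ?thesis unfolding surpassed_within_def q' by auto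
  next
    case False
    from pq(2) own(1) have "p \<noteq> 0" by (intro notI) simp
    then obtain p' where p': "p = Suc p'" by (cases p) auto
    have "level a b v < a (fst v - ?s * int p')"
      using pq(2) le False by (simp add: next_site_def p' algebra_simps)
    moreover have "level a b v < b (snd v - ?s * int q)"
      using pq(3) le False by (simp add: next_site_def)
    ultimately show ?thesis unfolding surpassed_within_def p' by auto
  qed
  then have "depth a b v \<le> p + q - 1" "0 < p + q"
    unfolding depth_def by (auto intro: Least_le)
  then show ?thesis using pq(1) by linarith
qed

text \<open>If all lines had the same colour, then the labels would be monotone and hence bounded on one side.\<close>

lemma unbounded_both_ways_lines:
  assumes "unbounded_both_ways a"
  shows "\<exists>i. line_open a i" "\<exists>i. \<not> line_open a i"
proof -
  show "\<exists>i. line_open a i"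
  proof (rule ccontr)
    assume "\<not> ?thesis"
    then have step: "a i \<le> a (i - 1)" for i
      unfolding line_open_def not_ex not_less by (rule spec)
    have "a (int p) \<le> a 0" for p
    proof (induction p)
      case (Suc p)
      with step[of "int (Suc p)"] show ?case by simp
    qed simp
    moreover obtain p :: nat where "a 0 < a (0 + int p)"
      using assms unfolding unbounded_both_ways_def by blast
    ultimately show False by (metis add_0 leD)
  qed
  show "\<exists>i. \<not> line_open a i"
  proof (rule ccontr)
    assume "\<not> ?thesis"
    then have step: "a (i - 1) < a i" for i
      unfolding line_open_def not_ex not_not by (rule spec)
    have "a (- int p) \<le> a 0" for p
    proof (induction p)
      case (Suc p)
      have eq: "- int (Suc p) = - int p - 1" by simp
      show ?case
        using less_imp_le[OF step[of "- int p"]] Suc unfolding eq by (rule order_trans)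
    qed simp
    moreover obtain p :: nat where "a 0 < a (0 - int p)"
      using assms unfolding unbounded_both_ways_def by blast
    ultimately show False by (metis diff_0 leD)
  qed
qed

lemma colour_both_values:
  assumes "unbounded_both_ways a" "unbounded_both_ways b"
  shows "\<exists>v. colour a b v = c"
proof -
  have "\<exists>i. line_open a i = c" "\<exists>j. line_open b j = c"
    using unbounded_both_ways_lines[OF assms(1)] unbounded_both_ways_lines[OF assms(2)]
    by (cases c; auto)+
  then obtain i j where "line_open a i = c" "line_open b j = c" by blast
  then have "colour a b (i, j) = c" by (simp add: colour_def)
  then show ?thesis by blast
qed

text \<open>The increasing depth makes the path self-avoiding, and it provides the weights that are summable
  along it.\<close>

lemma infinite_coloured_path:
  assumes "unbounded_both_ways a" "unbounded_both_ways b"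
  obtains v :: "nat \<Rightarrow> site"
  where "\<And>k. colour a b (v k) = c" "\<And>k. nearest_neighbors (v k) (v (Suc k))"
    "\<And>k. k \<le> depth a b (v k)" "inj v"
proof -
  obtain v0 where v0: "colour a b v0 = c" using colour_both_values[OF assms] by blast
  define v where "v k = (next_site a b ^^ k) v0" for k
  have vS: "v (Suc k) = next_site a b (v k)" for k by (simp add: v_def)
  have mono: "strict_mono (\<lambda>k. depth a b (v k))"
    by (simp add: strict_mono_Suc_iff vS depth_next_site[OF assms])
  show thesis
  proof
    show "colour a b (v k) = c" for k
      by (induction k) (simp_all add: vS colour_next_site, simp add: v_def v0)
    show "nearest_neighbors (v k) (v (Suc k))" for k
      by (simp add: vS nearest_neighbors_next_site)
    show "k \<le> depth a b (v k)" for k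
      using strict_mono_imp_increasing[OF mono] .
    show "inj v"
      using strict_mono_imp_inj_on[OF mono] by (metis inj_on_def)
  qed
qed

section \<open>Infinite clusters from infinite paths\<close>

lemma communicate_refl: "communicate \<omega> x x"
  unfolding communicate_def by (intro exI[of _ "[x]"]) auto

lemma communicate_sym: "communicate \<omega> x y \<Longrightarrow> communicate \<omega> y x"
proof -
  assume "communicate \<omega> x y"
  then obtain zs where zs: "zs \<noteq> []" "hd zs = x" "last zs = y"
      "successively nearest_neighbors zs" "\<forall>u\<in>set zs. \<forall>v\<in>set zs. \<omega> u = \<omega> v"
    unfolding communicate_def by blast
  have "successively (\<lambda>x y. nearest_neighbors y x) zs"
    by (rule successively_mono[OF zs(4)]) (simp add: nearest_neighbors_def abs_minus_commute)
  then have "successively nearest_neighbors (rev zs)" unfolding successively_rev .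
  moreover have "rev zs \<noteq> []" "hd (rev zs) = y" "last (rev zs) = x"
    using zs(1-3) by (simp_all add: hd_rev last_rev)
  moreover have "\<forall>u\<in>set (rev zs). \<forall>v\<in>set (rev zs). \<omega> u = \<omega> v"
    using zs(5) unfolding set_rev .
  ultimately show ?thesis
    unfolding communicate_def by (intro exI[of _ "rev zs"] conjI)
qed

lemma communicate_trans:
  assumes "communicate \<omega> x y" "communicate \<omega> y z"
  shows "communicate \<omega> x z"
proof -
  obtain us where us: "us \<noteq> []" "hd us = x" "last us = y"
      "successively nearest_neighbors us" "\<forall>u\<in>set us. \<forall>v\<in>set us. \<omega> u = \<omega> v"
    using assms(1) unfolding communicate_def by blast
  obtain ws where ws: "ws \<noteq> []" "hd ws = y" "last ws = z"
      "successively nearest_neighbors ws" "\<forall>u\<in>set ws. \<forall>v\<in>set ws. \<omega> u = \<omega> v"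
    using assms(2) unfolding communicate_def by blast
  have "\<omega> u = \<omega> y" if "u \<in> set us" for u
    using us(5) that last_in_set[OF us(1)] unfolding us(3) by blast
  moreover have "\<omega> u = \<omega> y" if "u \<in> set ws" for u
    using ws(5) that hd_in_set[OF ws(1)] unfolding ws(2) by blast
  moreover have "u \<in> set us \<or> u \<in> set ws" if "u \<in> set (us @ tl ws)" for u
    using that list.set_sel(2)[OF ws(1), of u] by auto
  ultimately have "\<omega> u = \<omega> y" if "u \<in> set (us @ tl ws)" for u
    using that by blast
  then have "\<forall>u\<in>set (us @ tl ws). \<forall>v\<in>set (us @ tl ws). \<omega> u = \<omega> v"
    by simp
  moreover have "last (us @ tl ws) = z"
    using us(1,3) ws(1-3) by (cases ws) (auto simp: last_append)
  moreover have "successively nearest_neighbors (us @ tl ws)"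
    using us(1,3,4) ws(1,2,4) by (cases ws) (auto simp: successively_append_iff successively_Cons)
  moreover have "us @ tl ws \<noteq> []" "hd (us @ tl ws) = x"
    using us(1,2) by simp_all
  ultimately show ?thesis
    unfolding communicate_def by (intro exI[of _ "us @ tl ws"] conjI)
qed

lemma communicate_value: "communicate \<omega> x y \<Longrightarrow> \<omega> x = \<omega> y"
  unfolding communicate_def by (metis hd_in_set last_in_set)

lemma communicate_step:
  "nearest_neighbors x y \<Longrightarrow> \<omega> x = \<omega> y \<Longrightarrow> communicate \<omega> x y"
  unfolding communicate_def by (intro exI[of _ "[x, y]"]) auto

lemma connected_component_of_site:
  "connected_component_of_config \<omega> {y. communicate \<omega> x y}"
  unfolding connected_component_of_config_def mutually_communicating_def
proof (intro conjI allI impI ballI)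
  show "communicate \<omega> y z" if "y \<in> {y. communicate \<omega> x y}" "z \<in> {y. communicate \<omega> x y}" for y z
    using that communicate_trans[OF communicate_sym[of \<omega> x y], of z] by simp
  fix D
  assume D: "{y. communicate \<omega> x y} \<subseteq> D \<and> (\<forall>x\<in>D. \<forall>y\<in>D. communicate \<omega> x y)"
  from D have D1: "{y. communicate \<omega> x y} \<subseteq> D" ..
  from D have D2: "\<forall>x\<in>D. \<forall>y\<in>D. communicate \<omega> x y" ..
  have "x \<in> {y. communicate \<omega> x y}" by (rule CollectI) (rule communicate_refl)
  then have "x \<in> D" by (rule subsetD[OF D1])
  then have "D \<subseteq> {y. communicate \<omega> x y}" by (intro subsetI CollectI D2[rule_format])
  then show "D = {y. communicate \<omega> x y}" using D1 by (rule subset_antisym)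
qed

text \<open>Infinitude of the component is written with lists of sites, which are countable in number, so that
  measurability is evident.\<close>

definition percolates :: "bool \<Rightarrow> config \<Rightarrow> bool" where
  "percolates c \<omega> \<longleftrightarrow>
     (\<exists>x. \<omega> x = c \<and> (\<forall>ys :: site list. \<exists>y. y \<notin> set ys \<and> communicate \<omega> x y))"

lemma infinite_clusters_if_percolates:
  "percolates True \<omega> \<Longrightarrow> \<exists>C. open_cluster \<omega> C \<and> infinite C"
  "percolates False \<omega> \<Longrightarrow> \<exists>C. closed_cluster \<omega> C \<and> infinite C"
proof -
  have *: "\<exists>C. connected_component_of_config \<omega> C \<and> (\<forall>x\<in>C. \<omega> x = c) \<and> infinite C"
    if "percolates c \<omega>" for c
  proof -
    from that obtain x where
      x: "\<omega> x = c \<and> (\<forall>ys :: site list. \<exists>y. y \<notin> set ys \<and> communicate \<omega> x y)"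
      unfolding percolates_def ..
    have "infinite {y. communicate \<omega> x y}"
    proof
      assume "finite {y. communicate \<omega> x y}"
      then obtain ys where "set ys = {y. communicate \<omega> x y}" using finite_list by blast
      with conjunct2[OF x] show False by (metis mem_Collect_eq)
    qed
    then show ?thesis
      using connected_component_of_site[of \<omega> x] communicate_value[of \<omega> x] conjunct1[OF x]
      by (intro exI[of _ "{y. communicate \<omega> x y}"]) auto
  qed
  show "percolates True \<omega> \<Longrightarrow> \<exists>C. open_cluster \<omega> C \<and> infinite C"
    "percolates False \<omega> \<Longrightarrow> \<exists>C. closed_cluster \<omega> C \<and> infinite C"
    using *[of True] *[of False] unfolding open_cluster_def closed_cluster_def
    by (simp_all only: conj_assoc simp_thms)
qed

lemma percolates_if_path:
  fixes v :: "nat \<Rightarrow> site"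
  assumes "inj v" "\<And>k. nearest_neighbors (v k) (v (Suc k))"
    and "\<forall>\<^sub>F k in sequentially. \<omega> (v k) = c"
  shows "percolates c \<omega>"
proof -
  obtain N where N: "\<And>k. N \<le> k \<Longrightarrow> \<omega> (v k) = c"
    using assms(3) unfolding eventually_sequentially by blast
  have conn: "communicate \<omega> (v N) (v (N + k))" for k
  proof (induction k)
    case 0
    show ?case by (simp add: communicate_refl)
  next
    case (Suc k)
    have "communicate \<omega> (v (N + k)) (v (N + Suc k))"
      using communicate_step[OF assms(2)[of "N + k"]] N by simp
    with Suc show ?case by (rule communicate_trans)
  qed
  have "inj (\<lambda>k. v (N + k))" by (rule injI) (use injD[OF assms(1)] in fastforce)
  then have inf: "infinite (range (\<lambda>k. v (N + k)))" by (rule range_inj_infinite)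
  have "\<exists>y. y \<notin> set ys \<and> communicate \<omega> (v N) y" for ys :: "site list"
  proof -
    have "\<not> range (\<lambda>k. v (N + k)) \<subseteq> set ys"
      using inf finite_subset by blast
    then obtain k where "v (N + k) \<notin> set ys" by blast
    with conn show ?thesis by blast
  qed
  then show ?thesis unfolding percolates_def using N[of N] by blast
qed

section \<open>Fields of independent geometric labels\<close>

text \<open>The geometric distribution is used for the labels of the lines and for the noise
  because every natural number has positive probability and these probabilities are summable.\<close>

abbreviation geo :: "nat measure" where
  "geo \<equiv> measure_pmf (geometric_pmf (1 / 2))"

definition geo_field :: "('i \<Rightarrow> nat) measure" where
  "geo_field = PiM UNIV (\<lambda>_. geo)"

lemma prob_space_geo_field: "prob_space geo_field"
  unfolding geo_field_def by (intro prob_space_PiM measure_pmf.prob_space_axioms)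

lemma space_geo_field [simp]: "space geo_field = UNIV"
  by (simp add: geo_field_def space_PiM)

lemma measurable_geo_field_component [measurable]:
  "(\<lambda>l. l i) \<in> measurable geo_field (count_space UNIV)"
proof -
  have "(\<lambda>l. l i) \<in> measurable geo_field geo"
    unfolding geo_field_def by (rule measurable_component_singleton) simp
  then show ?thesis by simp
qed

lemma measurable_geo_fieldI:
  assumes "\<And>i. (\<lambda>x. f x i) \<in> measurable M (count_space UNIV)"
  shows "f \<in> measurable M geo_field"
  unfolding geo_field_def by (intro measurable_PiM_single') (use assms in auto)

lemma measure_geo_field_component:
  "measure geo_field {l. l i = m} = (1 / 2) ^ Suc m"
proof -
  interpret product_prob_space "\<lambda>_. geo" UNIV by unfold_locales
  have "emeasure (PiM UNIV (\<lambda>_. geo)) {l \<in> space (PiM UNIV (\<lambda>_. geo)). l i \<in> {m}} = emeasure geo {m}"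
    by (rule emeasure_PiM_Collect_single) auto
  also have "\<dots> = ennreal ((1 / 2) ^ Suc m)"
    by (simp add: emeasure_pmf_single)
  finally show ?thesis by (simp add: measure_def geo_field_def space_PiM)
qed

lemma AE_geo_field_attains:
  fixes g :: "nat \<Rightarrow> 'i"
  assumes "inj g"
  shows "AE l in geo_field. \<exists>k. l (g k) = m"
proof -
  interpret product_prob_space "\<lambda>_. geo" "UNIV :: 'i set" by unfold_locales
  let ?M = "geo_field :: ('i \<Rightarrow> nat) measure"
  interpret prob_space ?M by (rule prob_space_geo_field)
  have meas: "{l. \<forall>k\<in>K. l (g k) \<noteq> m} \<in> sets ?M" for K
  proof -
    have "Measurable.pred ?M (\<lambda>l. \<forall>k\<in>K. l (g k) \<noteq> m)" by measurable
    then show ?thesis by (simp add: pred_def)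
  qed
  define c :: real where "c = measure geo (- {m})"
  have "0 < measure geo {m}"
    by (simp add: measure_pmf_single)
  then have c: "0 \<le> c" "c < 1"
    unfolding c_def using measure_pmf.prob_compl[of "{m}" "geometric_pmf (1 / 2)"]
    by (simp_all add: Compl_eq_Diff_UNIV)
  have bound: "measure ?M {l. \<forall>k\<in>UNIV. l (g k) \<noteq> m} \<le> c ^ n" for n
  proof -
    have "measure ?M {l. \<forall>k\<in>UNIV. l (g k) \<noteq> m} \<le> measure ?M {l. \<forall>k\<in>{..<n}. l (g k) \<noteq> m}"
      by (intro finite_measure_mono meas) auto
    also have "{l. \<forall>k\<in>{..<n}. l (g k) \<noteq> m} =
        prod_emb UNIV (\<lambda>_. geo) (g ` {..<n}) (Pi\<^sub>E (g ` {..<n}) (\<lambda>_. - {m}))"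
      by (auto simp: prod_emb_def space_PiM Pi_iff)
    also have "measure ?M \<dots> = (\<Prod>i\<in>g ` {..<n}. c)"
      unfolding c_def geo_field_def by (rule measure_PiM_emb) auto
    also have "\<dots> = c ^ n"
      using card_image[OF inj_on_subset[OF assms subset_UNIV], of "{..<n}"] by simp
    finally show ?thesis .
  qed
  have "(\<lambda>n. c ^ n) \<longlonglongrightarrow> 0" using c by (intro LIMSEQ_power_zero) simp
  then have "measure ?M {l. \<forall>k\<in>UNIV. l (g k) \<noteq> m} \<le> 0"
    by (rule LIMSEQ_le_const) (use bound in blast)
  then have "measure ?M {l. \<forall>k\<in>UNIV. l (g k) \<noteq> m} = 0" by (simp add: measure_le_0_iff)
  then have "AE l in ?M. l \<notin> {l. \<forall>k\<in>UNIV. l (g k) \<noteq> m}"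
    using prob_eq_0[OF meas[of UNIV]] by simp
  then show ?thesis by simp
qed

text \<open>This is the Borel-Cantelli lemma, with the bound \<open>(1 / 2) ^ k\<close> for the probability of
  hitting \<open>d k\<close>.\<close>

lemma AE_geo_field_eventually_avoids:
  fixes v :: "nat \<Rightarrow> 'i" and d :: "nat \<Rightarrow> nat"
  assumes "\<And>k. k \<le> d k"
  shows "AE n in geo_field. \<forall>\<^sub>F k in sequentially. n (v k) \<noteq> d k"
proof -
  let ?M = "geo_field :: ('i \<Rightarrow> nat) measure"
  interpret prob_space ?M by (rule prob_space_geo_field)
  have "AE n in ?M. \<forall>\<^sub>F k in sequentially. n \<in> space ?M - {n. n (v k) = d k}"
  proof (rule borel_cantelli_AE1)
    have "Measurable.pred ?M (\<lambda>n. n (v k) = d k)" for k by measurable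
    then show "{n. n (v k) = d k} \<in> sets ?M" for k by (simp add: pred_def)
    show "emeasure ?M {n. n (v k) = d k} < \<infinity>" for k
      by (simp add: emeasure_eq_measure)
    have bound: "norm (measure ?M {n. n (v k) = d k}) \<le> (1 / 2) ^ k" for k
    proof -
      have "(1 / 2 :: real) ^ Suc (d k) \<le> (1 / 2) ^ k"
        using assms[of k] by (intro power_decreasing) simp_all
      then show ?thesis unfolding measure_geo_field_component by simp
    qed
    have "summable (\<lambda>k. (1 / 2 :: real) ^ k)" by (rule summable_geometric) simp
    then show "summable (\<lambda>k. measure ?M {n. n (v k) = d k})"
      by (rule summable_comparison_test'[OF _ bound])
  qed
  then show ?thesis by simp
qed

lemma distr_geo_field_reindex:
  assumes "inj (f :: 'i \<Rightarrow> 'i)"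
  shows "distr geo_field geo_field (\<lambda>l. l \<circ> f) = geo_field"
proof -
  have "distr (PiM UNIV (\<lambda>_::'i. geo)) (PiM UNIV (\<lambda>_::'i. geo)) (\<lambda>l. \<lambda>i\<in>UNIV. l (f i)) = PiM UNIV (\<lambda>_. geo)"
    using distr_PiM_reindex[of UNIV "\<lambda>_. geo" f UNIV, OF measure_pmf.prob_space_axioms] assms
    by simp
  then show ?thesis by (simp add: geo_field_def comp_def restrict_UNIV)
qed

text \<open>Replacing one coordinate by an independent copy preserves the product measure, and the copy attains
  every natural number with positive probability. So an almost sure property survives arbitrary
  changes of one coordinate.\<close>

lemma AE_geo_field_resample:
  assumes "AE n in geo_field. P n"
  shows "AE n in geo_field. \<forall>u. P (n((x :: 'i) := u))"
proof -
  let ?M = "geo_field :: ('i \<Rightarrow> nat) measure"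
  interpret prob_space ?M by (rule prob_space_geo_field)
  interpret pair_sigma_finite geo ?M ..
  interpret swapped: pair_sigma_finite ?M geo ..
  have meas: "(\<lambda>(u, n). n(x := u)) \<in> measurable (geo \<Otimes>\<^sub>M ?M) ?M"
    unfolding case_prod_beta
    by (intro measurable_geo_fieldI) (auto simp: fun_upd_def)
  have eq: "distr (geo \<Otimes>\<^sub>M ?M) ?M (\<lambda>(u, n). n(x := u)) = ?M"
    using distr_pair_PiM_eq_PiM[of UNIV "\<lambda>_. geo" x, OF measure_pmf.prob_space_axioms
        measure_pmf.prob_space_axioms]
    by (simp add: geo_field_def)
  have "AE n in distr (geo \<Otimes>\<^sub>M ?M) ?M (\<lambda>(u, n). n(x := u)). P n"
    unfolding eq by (rule assms)
  from AE_distrD[OF meas this]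
  have "AE p in geo \<Otimes>\<^sub>M ?M. P ((\<lambda>(u, n). n(x := u)) p)" .
  then have "AE p in distr (?M \<Otimes>\<^sub>M geo) (geo \<Otimes>\<^sub>M ?M) (\<lambda>(n, u). (u, n)). P ((\<lambda>(u, n). n(x := u)) p)"
    by (subst (asm) distr_pair_swap)
  then have "AE p in ?M \<Otimes>\<^sub>M geo. P ((fst p)(x := snd p))"
    by (auto simp: case_prod_beta dest!: AE_distrD[rotated])
  then have "AE n in ?M. AE u in geo. P (n(x := u))"
    by (auto dest!: swapped.AE_pair)
  then show ?thesis
    by (simp add: AE_measure_pmf_iff set_pmf_geometric)
qed

section \<open>The percolation\<close>

text \<open>The first component of \<open>\<omega>\<close> labels the columns (\<^const>\<open>Inl\<close>) and the rows (\<^const>\<open>Inr\<close>); the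
  second component is the noise. Testing the noise for equality with the depth gives the flip the
  probability \<open>(1 / 2) ^ Suc k\<close> at depth \<open>k\<close>.\<close>

definition woven :: "(int + int \<Rightarrow> nat) \<times> (site \<Rightarrow> nat) \<Rightarrow> config" where
  "woven \<omega> v \<longleftrightarrow>
     colour (fst \<omega> \<circ> Inl) (fst \<omega> \<circ> Inr) v \<noteq> (snd \<omega> v = depth (fst \<omega> \<circ> Inl) (fst \<omega> \<circ> Inr) v)"

abbreviation woven_space :: "((int + int \<Rightarrow> nat) \<times> (site \<Rightarrow> nat)) measure" where
  "woven_space \<equiv> geo_field \<Otimes>\<^sub>M geo_field"

lemma measurable_countable_binop:
  fixes f :: "'a \<Rightarrow> 'b :: countable" and g :: "'a \<Rightarrow> 'c :: countable"
  assumes f: "f \<in> measurable M (count_space UNIV)" and g: "g \<in> measurable M (count_space UNIV)"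
  shows "(\<lambda>x. h (f x) (g x)) \<in> measurable M (count_space UNIV)"
  by (rule measurable_compose_countable[OF measurable_compose_countable[OF _ g] f]) simp

lemma measurable_line_level:
  "(\<lambda>l. line_level (l \<circ> c) i) \<in> measurable geo_field (count_space UNIV)"
  unfolding line_level_def comp_def
  by (intro measurable_countable_binop[where h = max] measurable_geo_field_component)

lemma measurable_line_open:
  "(\<lambda>l. line_open (l \<circ> c) i) \<in> measurable geo_field (count_space UNIV)"
  unfolding line_open_def comp_def
  by (intro measurable_countable_binop[where h = "(<)"] measurable_geo_field_component)

lemma measurable_colour:
  "(\<lambda>l. colour (l \<circ> Inl) (l \<circ> Inr) v) \<in> measurable geo_field (count_space UNIV)"
proof -
  have [measurable]: "Measurable.pred geo_field (\<lambda>l. column_on_top (l \<circ> Inl) (l \<circ> Inr) v)"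
    unfolding column_on_top_def
    by (intro measurable_countable_binop[where h = "(<)"] measurable_line_level)
  note measurable_line_open [measurable]
  show ?thesis unfolding colour_def by measurable
qed

lemma measurable_depth:
  "(\<lambda>l. depth (l \<circ> Inl) (l \<circ> Inr) v) \<in> measurable geo_field (count_space UNIV)"
proof -
  note measurable_colour [measurable]
  have [measurable]: "(\<lambda>l. direction (l \<circ> Inl) (l \<circ> Inr) v) \<in> measurable geo_field (count_space UNIV)"
    unfolding direction_def by measurable
  have [measurable]: "(\<lambda>l. level (l \<circ> Inl) (l \<circ> Inr) v) \<in> measurable geo_field (count_space UNIV)"
    unfolding level_def
    by (intro measurable_countable_binop[where h = max] measurable_line_level)
  \<comment> \<open>The coordinate that is read depends on the random direction, which has countably many values.\<close>
  have coord: "(\<lambda>l. l (c (i - direction (l \<circ> Inl) (l \<circ> Inr) v * k)))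
      \<in> measurable geo_field (count_space UNIV)" for c :: "int \<Rightarrow> int + int" and i k
    by (rule measurable_compose_countable[where f = "\<lambda>s l. l (c (i - s * k))"]) measurable
  have [measurable]: "Measurable.pred geo_field (\<lambda>l. level (l \<circ> Inl) (l \<circ> Inr) v <
      (l \<circ> c) (i - direction (l \<circ> Inl) (l \<circ> Inr) v * k))" for c i k
    unfolding comp_apply[of _ c]
    by (rule measurable_countable_binop[where h = "(<)", OF _ coord]) measurable
  show ?thesis unfolding depth_def surpassed_within_def by measurable
qed

lemma measurable_woven: "woven \<in> measurable woven_space (config_space UNIV)"
proof -
  have "(\<lambda>\<omega>. woven \<omega> v) \<in> measurable woven_space (count_space UNIV)" for v
  proof -
    note measurable_compose[OF measurable_fst measurable_colour, measurable]
    have [measurable]: "Measurable.pred woven_space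
        (\<lambda>\<omega>. snd \<omega> v = depth (fst \<omega> \<circ> Inl) (fst \<omega> \<circ> Inr) v)"
      by (rule measurable_countable_binop[where h = "(=)",
            OF measurable_compose[OF measurable_snd measurable_geo_field_component]
               measurable_compose[OF measurable_fst measurable_depth]])
    show ?thesis unfolding woven_def by measurable
  qed
  then show ?thesis
    unfolding config_space_def by (intro measurable_PiM_single') auto
qed

section \<open>A criterion for finite energy\<close>

lemma measurable_config_component:
  "x \<in> V \<Longrightarrow> (\<lambda>\<omega>. \<omega> x) \<in> measurable (config_space V) (count_space UNIV)"
  unfolding config_space_def by (rule measurable_component_singleton)

lemma measurable_off_site:
  assumes "X \<in> measurable M (config_space UNIV)"
  shows "off_site X x \<in> measurable M (config_space (- {x}))"
proof -
  have "(\<lambda>\<omega>. restrict \<omega> (- {x})) \<in> measurable (config_space UNIV) (config_space (- {x}))"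
    unfolding config_space_def by (rule measurable_restrict_subset) simp
  from measurable_compose[OF assms this] show ?thesis
    unfolding off_site_def .
qed

text \<open>The conditional probability that \<open>x\<close> is open is the Radon-Nikodym derivative
  \<open>r\<close> of the law of the configuration off \<open>x\<close> on the event that \<open>x\<close> is open, with respect to the
  law \<open>\<rho>\<close> of the configuration off \<open>x\<close>. On \<open>r = 0\<close> the site is almost surely closed and on
  \<open>r \<ge> 1\<close> it is almost surely open, so both are null events, because no event of positive
  probability that is determined off \<open>x\<close> forces the value at \<open>x\<close>. There the version can be redefined
  as \<open>1 / 2\<close>.\<close>

lemma finite_energy_if_both_values_possible:
  assumes perc: "site_percolation M X"
    and possible: "\<And>x E c. E \<in> sets (config_space (- {x})) \<Longrightarrow>
      AE \<omega> in M. off_site X x \<omega> \<in> E \<longrightarrow> X \<omega> x \<noteq> c \<Longrightarrow>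
      AE \<omega> in M. off_site X x \<omega> \<notin> E"
  shows "finite_energy M X"
proof -
  interpret prob_space M using perc by (simp add: site_percolation_def)
  have X: "X \<in> measurable M (config_space UNIV)" using perc by (simp add: site_percolation_def)
  have "\<exists>q. cond_prob_version M X x q \<and>
      (\<forall>\<xi>\<in>space (config_space (- {x})). 0 < q \<xi> \<and> q \<xi> < 1)" for x
  proof -
    define C where "C = config_space (- {x})"
    define Y where "Y = off_site X x"
    define A where "A = {\<omega> \<in> space M. X \<omega> x}"
    have Y [measurable]: "Y \<in> measurable M C"
      unfolding Y_def C_def using X by (rule measurable_off_site)
    have "Measurable.pred M (\<lambda>\<omega>. X \<omega> x)"
      using measurable_compose[OF X measurable_config_component] by simp
    then have A [measurable]: "A \<in> sets M" by (simp add: A_def pred_def)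
    define \<rho> where "\<rho> = distr M C Y"
    define \<rho>1 where "\<rho>1 = distr (density M (indicator A)) C Y"
    interpret \<rho>: prob_space \<rho> unfolding \<rho>_def by (rule prob_space_distr) (rule Y)
    have sets_\<rho>: "sets \<rho> = sets C" and sets_\<rho>1: "sets \<rho>1 = sets \<rho>"
      by (simp_all add: \<rho>_def \<rho>1_def)
    have em_\<rho>1: "emeasure \<rho>1 E = emeasure M (A \<inter> (Y -` E \<inter> space M))" if "E \<in> sets C" for E
    proof -
      have [measurable]: "Y -` E \<inter> space M \<in> sets M" using that by measurable
      have "emeasure \<rho>1 E = (\<integral>\<^sup>+ \<omega>. indicator A \<omega> * indicator (Y -` E \<inter> space M) \<omega> \<partial>M)"
        using that unfolding \<rho>1_def by (simp add: emeasure_distr emeasure_density)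
      also have "\<dots> = (\<integral>\<^sup>+ \<omega>. indicator (A \<inter> (Y -` E \<inter> space M)) \<omega> \<partial>M)"
        by (simp add: indicator_inter_arith)
      finally show ?thesis by simp
    qed
    have em_\<rho>: "emeasure \<rho> E = emeasure M (Y -` E \<inter> space M)" if "E \<in> sets C" for E
      using that unfolding \<rho>_def by (simp add: emeasure_distr)
    have "absolutely_continuous \<rho> \<rho>1"
      unfolding absolutely_continuous_def
    proof
      fix E assume E: "E \<in> null_sets \<rho>"
      then have EC: "E \<in> sets C" using sets_\<rho> by auto
      have [measurable]: "Y -` E \<inter> space M \<in> sets M" using EC by measurable
      have "emeasure \<rho>1 E \<le> emeasure \<rho> E"
        unfolding em_\<rho>[OF EC] em_\<rho>1[OF EC] by (intro emeasure_mono) auto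
      with E EC show "E \<in> null_sets \<rho>1" by (simp add: null_sets_def sets_\<rho>1 sets_\<rho>)
    qed
    note dens = \<rho>.density_RN_deriv[OF this sets_\<rho>1]
    define r where "r = RN_deriv \<rho> \<rho>1"
    have r\<rho> [measurable]: "r \<in> borel_measurable \<rho>" unfolding r_def by simp
    have r [measurable]: "r \<in> borel_measurable C"
      using r\<rho> measurable_cong_sets[OF sets_\<rho> refl] by blast
    have r_int: "(\<integral>\<^sup>+ \<xi>. r \<xi> * indicator E \<xi> \<partial>\<rho>) = emeasure M (A \<inter> (Y -` E \<inter> space M))"
      if "E \<in> sets C" for E
    proof -
      have "emeasure \<rho>1 E = (\<integral>\<^sup>+ \<xi>. r \<xi> * indicator E \<xi> \<partial>\<rho>)"
        using emeasure_density[OF r\<rho>, of E] that sets_\<rho> unfolding r_def dens by simp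
      with em_\<rho>1[OF that] show ?thesis by simp
    qed
    have "AE \<omega> in M. Y \<omega> \<notin> {\<xi> \<in> space C. r \<xi> = 0}"
    proof -
      let ?E = "{\<xi> \<in> space C. r \<xi> = 0}"
      have E: "?E \<in> sets C" by measurable
      have S: "A \<inter> (Y -` ?E \<inter> space M) \<in> sets M" using measurable_sets[OF Y E] by auto
      have "(\<integral>\<^sup>+ \<xi>. r \<xi> * indicator ?E \<xi> \<partial>\<rho>) = (\<integral>\<^sup>+ \<xi>. 0 \<partial>\<rho>)"
        by (intro nn_integral_cong) (auto simp: indicator_def)
      then have "A \<inter> (Y -` ?E \<inter> space M) \<in> null_sets M"
        using r_int[OF E] S by (simp add: null_sets_def)
      then have "AE \<omega> in M. \<omega> \<notin> A \<inter> (Y -` ?E \<inter> space M)" by (rule AE_not_in)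
      then have "AE \<omega> in M. Y \<omega> \<in> ?E \<longrightarrow> X \<omega> x \<noteq> True"
        by (rule AE_mp) (auto intro!: AE_I2 simp: A_def)
      then show ?thesis unfolding Y_def by (rule possible[OF E[unfolded C_def], folded C_def])
    qed
    moreover have "AE \<omega> in M. Y \<omega> \<notin> {\<xi> \<in> space C. 1 \<le> r \<xi>}"
    proof -
      let ?E = "{\<xi> \<in> space C. 1 \<le> r \<xi>}"
      let ?B = "Y -` ?E \<inter> space M"
      have E: "?E \<in> sets C" by measurable
      have B: "?B \<in> sets M" using measurable_sets[OF Y E] .
      have "emeasure M ?B = (\<integral>\<^sup>+ \<xi>. indicator ?E \<xi> \<partial>\<rho>)"
        using E sets_\<rho> em_\<rho>[OF E] by simp
      also have "\<dots> \<le> (\<integral>\<^sup>+ \<xi>. r \<xi> * indicator ?E \<xi> \<partial>\<rho>)"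
        by (intro nn_integral_mono) (auto simp: indicator_def)
      finally have le: "emeasure M ?B \<le> emeasure M (A \<inter> ?B)" using r_int[OF E] by simp
      have "emeasure M (?B - A \<inter> ?B) = emeasure M ?B - emeasure M (A \<inter> ?B)"
        using A B by (intro emeasure_Diff) auto
      also have "\<dots> = 0" using le by (intro diff_eq_0_ennreal) (auto simp: emeasure_eq_measure)
      finally have "?B - A \<inter> ?B \<in> null_sets M" using A B by (auto simp: null_sets_def)
      then have "AE \<omega> in M. \<omega> \<notin> ?B - A \<inter> ?B" by (rule AE_not_in)
      then have "AE \<omega> in M. Y \<omega> \<in> ?E \<longrightarrow> X \<omega> x \<noteq> False"
        by (rule AE_mp) (auto intro!: AE_I2 simp: A_def)
      then show ?thesis unfolding Y_def by (rule possible[OF E[unfolded C_def], folded C_def])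
    qed
    moreover have "AE \<omega> in M. \<omega> \<in> space M" by (rule AE_space)
    ultimately have r_bounds: "AE \<omega> in M. 0 < r (Y \<omega>) \<and> r (Y \<omega>) < 1"
    proof eventually_elim
      case (elim \<omega>)
      then show ?case
        using measurable_space[OF Y, of \<omega>] by (simp add: not_le zero_less_iff_neq_zero)
    qed
    define q where "q \<xi> = (if 0 < r \<xi> \<and> r \<xi> < 1 then enn2real (r \<xi>) else 1 / 2)" for \<xi>
    have q [measurable]: "q \<in> borel_measurable C" unfolding q_def by measurable
    have q01: "0 < q \<xi>" "q \<xi> < 1" for \<xi>
      by (cases "r \<xi>"; auto simp: q_def)+
    have qr: "AE \<omega> in M. ennreal (q (Y \<omega>)) = r (Y \<omega>)"
      using r_bounds by eventually_elim (metis ennreal_enn2real ennreal_one_less_top less_trans q_def)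
    define F where "F = vimage_algebra (space M) Y C"
    have Y_space: "Y \<in> space M \<rightarrow> space C" using measurable_space[OF Y] by auto
    have sets_F: "sets F = {Y -` E \<inter> space M | E. E \<in> sets C}"
      unfolding F_def by (rule sets_vimage_algebra2[OF Y_space])
    have "subalgebra M F"
      unfolding subalgebra_def using sets_F measurable_sets[OF Y] by (auto simp: F_def)
    then interpret finite_measure_subalgebra M F by unfold_locales
    have "AE \<omega> in M. real_cond_exp M F (indicator A) \<omega> = q (Y \<omega>)"
    proof (rule real_cond_exp_charact)
      show "integrable M (indicator A :: _ \<Rightarrow> real)" using A by (simp add: less_top[symmetric])
      show "integrable M (\<lambda>\<omega>. q (Y \<omega>))"
      proof (rule integrable_const_bound[where B = 1])
        show "AE \<omega> in M. norm (q (Y \<omega>)) \<le> 1"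
          by (rule AE_I2) (use q01 in \<open>simp add: less_imp_le\<close>)
      qed measurable
      have "Y \<in> measurable F C" unfolding F_def by (rule measurable_vimage_algebra1[OF Y_space])
      then show "(\<lambda>\<omega>. q (Y \<omega>)) \<in> borel_measurable F" using q by (rule measurable_compose)
      fix B assume "B \<in> sets F"
      then obtain E where E: "E \<in> sets C" "B = Y -` E \<inter> space M" unfolding sets_F by blast
      have B [measurable]: "B \<in> sets M" unfolding E(2) using measurable_sets[OF Y E(1)] .
      have "(\<integral>\<^sup>+ \<omega>. ennreal (indicator B \<omega> * q (Y \<omega>)) \<partial>M) = (\<integral>\<^sup>+ \<omega>. r (Y \<omega>) * indicator E (Y \<omega>) \<partial>M)"
      proof (rule nn_integral_cong_AE)
        show "AE \<omega> in M. ennreal (indicator B \<omega> * q (Y \<omega>)) = r (Y \<omega>) * indicator E (Y \<omega>)"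
          using qr AE_space[of M] by eventually_elim (auto simp: E(2) indicator_def)
      qed
      also have "\<dots> = (\<integral>\<^sup>+ \<xi>. r \<xi> * indicator E \<xi> \<partial>\<rho>)"
        unfolding \<rho>_def using E(1) by (intro nn_integral_distr[symmetric]) auto
      also have "\<dots> = emeasure M (A \<inter> B)" using r_int[OF E(1)] E(2) by simp
      finally have nn: "(\<integral>\<^sup>+ \<omega>. ennreal (indicator B \<omega> * q (Y \<omega>)) \<partial>M) = emeasure M (A \<inter> B)" .
      have "0 \<le> indicator B \<omega> * q (Y \<omega>)" for \<omega>
        using less_imp_le[OF q01(1)] by simp
      then have "(\<integral>\<omega>\<in>B. q (Y \<omega>) \<partial>M) = measure M (A \<inter> B)"
        unfolding set_lebesgue_integral_def real_scaleR_def
        by (subst integral_eq_nn_integral) (simp_all add: nn measure_def)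
      moreover have "(\<integral>\<omega>\<in>B. indicator A \<omega> \<partial>M) = measure M (A \<inter> B)"
        unfolding set_lebesgue_integral_def real_scaleR_def
        by (simp add: indicator_inter_arith[symmetric] Int_commute)
      ultimately show "(\<integral>\<omega>\<in>B. indicator A \<omega> \<partial>M) = (\<integral>\<omega>\<in>B. q (Y \<omega>) \<partial>M)" by simp
    qed
    then have "AE \<omega> in M. q (Y \<omega>) = real_cond_exp M F (indicator A) \<omega>"
      by eventually_elim simp
    then have "cond_prob_version M X x q"
      unfolding cond_prob_version_def using q by (simp add: F_def Y_def C_def A_def)
    with q01 show ?thesis by blast
  qed
  then show ?thesis unfolding finite_energy_def by metis
qed

section \<open>The law of the percolation\<close>

lemma measurable_percolates:
  "Measurable.pred (config_space UNIV) (percolates c)"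
proof -
  have [measurable]: "Measurable.pred (config_space UNIV) (\<lambda>\<omega>. \<omega> x)" for x
    by (rule measurable_config_component) simp
  have [measurable]: "Measurable.pred (config_space UNIV) (\<lambda>\<omega>. communicate \<omega> x y)" for x y
    unfolding communicate_def by measurable
  show ?thesis unfolding percolates_def by measurable
qed

text \<open>The injection \<open>c\<close> selects the columns or the rows among all lines.\<close>

lemma AE_unbounded_both_ways:
  assumes "inj c"
  shows "AE l in geo_field. unbounded_both_ways (l \<circ> c)"
proof -
  have attained: "AE l in geo_field. \<exists>k. l (c (i + s * int k)) = m" if "s \<noteq> 0" for i s m
    by (rule AE_geo_field_attains) (rule injI, use that injD[OF assms] in fastforce)
  have "AE l in geo_field. \<forall>i m. (\<exists>k. l (c (i + - 1 * int k)) = Suc m) \<and> (\<exists>k. l (c (i + 1 * int k)) = Suc m)"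
    unfolding AE_all_countable AE_conj_iff using attained[of "- 1"] attained[of 1] by simp
  then show ?thesis
  proof eventually_elim
    case (elim l)
    then show ?case unfolding unbounded_both_ways_def comp_def by (simp, metis lessI)
  qed
qed

lemma pair_geo_field: "pair_sigma_finite (geo_field :: ('i \<Rightarrow> nat) measure) (geo_field :: ('j \<Rightarrow> nat) measure)"
proof -
  interpret A: prob_space "geo_field :: ('i \<Rightarrow> nat) measure" by (rule prob_space_geo_field)
  interpret B: prob_space "geo_field :: ('j \<Rightarrow> nat) measure" by (rule prob_space_geo_field)
  show ?thesis ..
qed

definition woven_law :: "config measure" where
  "woven_law = distr woven_space (config_space UNIV) woven"

lemma AE_woven_law_iff:
  assumes "Measurable.pred (config_space UNIV) P"
  shows "(AE \<omega> in woven_law. P \<omega>) \<longleftrightarrow> (AE l in geo_field. AE n in geo_field. P (woven (l, n)))"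
proof -
  interpret pair_sigma_finite "geo_field :: (int + int \<Rightarrow> nat) measure" "geo_field :: (site \<Rightarrow> nat) measure"
    by (rule pair_geo_field)
  have "(AE \<omega> in woven_law. P \<omega>) \<longleftrightarrow> (AE p in woven_space. P (woven p))"
    unfolding woven_law_def using assms
    by (intro AE_distr_iff measurable_woven) (simp add: pred_def)
  also have "\<dots> \<longleftrightarrow> (AE l in geo_field. AE n in geo_field. P (woven (l, n)))"
    using AE_pair_iff[of "\<lambda>l n. P (woven (l, n))"] measurable_compose[OF measurable_woven assms]
    by (simp add: pred_def)
  finally show ?thesis .
qed

lemma site_percolation_woven_law: "site_percolation woven_law (\<lambda>\<omega>. \<omega>)"
proof -
  interpret A: prob_space "geo_field :: (int + int \<Rightarrow> nat) measure" by (rule prob_space_geo_field)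
  interpret B: prob_space "geo_field :: (site \<Rightarrow> nat) measure" by (rule prob_space_geo_field)
  interpret pair_prob_space "geo_field :: (int + int \<Rightarrow> nat) measure" "geo_field :: (site \<Rightarrow> nat) measure" ..
  show ?thesis
    unfolding site_percolation_def woven_law_def
    by (simp add: prob_space_distr measurable_woven)
qed

text \<open>Given the labels, an infinite path of the given colour is fixed, and since the depth at its \<open>k\<close>-th site
  is at least \<open>k\<close>, the independent noise flips only finitely many of its sites.\<close>

lemma AE_woven_law_percolates: "AE \<omega> in woven_law. percolates c \<omega>"
proof -
  have "AE l in geo_field. AE n in geo_field. percolates c (woven (l, n))"
    using AE_unbounded_both_ways[OF inj_Inl] AE_unbounded_both_ways[OF inj_Inr]
  proof eventually_elim
    case (elim l)
    then obtain v where v: "\<And>k. colour (l \<circ> Inl) (l \<circ> Inr) (v k) = c"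
        "\<And>k. nearest_neighbors (v k) (v (Suc k))" "\<And>k. k \<le> depth (l \<circ> Inl) (l \<circ> Inr) (v k)" "inj v"
      using infinite_coloured_path[where c = c] by metis
    have "AE n in geo_field. \<forall>\<^sub>F k in sequentially. n (v k) \<noteq> depth (l \<circ> Inl) (l \<circ> Inr) (v k)"
      by (rule AE_geo_field_eventually_avoids) (rule v(3))
    then show ?case
    proof eventually_elim
      case (elim n)
      then have "\<forall>\<^sub>F k in sequentially. woven (l, n) (v k) = c"
        by eventually_elim (simp add: woven_def v(1))
      then show ?case by (rule percolates_if_path[OF v(4,2)])
    qed
  qed
  then show ?thesis by (simp add: AE_woven_law_iff measurable_percolates)
qed

lemma off_site_woven_resample:
  "off_site (\<lambda>\<omega>. \<omega>) x (woven (l, n(x := u))) = off_site (\<lambda>\<omega>. \<omega>) x (woven (l, n))"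
  by (auto simp: off_site_def woven_def restrict_def fun_eq_iff)

lemma woven_resample_attains: "\<exists>u. woven (l, n(x := u)) x = c"
proof -
  let ?d = "depth (l \<circ> Inl) (l \<circ> Inr) x" and ?k = "colour (l \<circ> Inl) (l \<circ> Inr) x"
  have "woven (l, n(x := ?d)) x = (\<not> ?k)" "woven (l, n(x := Suc ?d)) x = ?k"
    by (simp_all add: woven_def)
  then show ?thesis by (cases "c = ?k") metis+
qed

text \<open>The noise at \<open>x\<close> affects no other site, and some value of it gives \<open>x\<close> the value \<open>c\<close>. So if
  \<open>c\<close> is almost surely avoided whenever the configuration off \<open>x\<close> lies in \<open>E\<close>, then resampling
  the noise at \<open>x\<close> shows that it almost surely does not lie in \<open>E\<close>.\<close>

lemma finite_energy_woven_law: "finite_energy woven_law (\<lambda>\<omega>. \<omega>)"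
proof (rule finite_energy_if_both_values_possible[OF site_percolation_woven_law])
  fix x and E :: "config set" and c
  assume E: "E \<in> sets (config_space (- {x}))"
    and avoid: "AE \<omega> in woven_law. off_site (\<lambda>\<omega>. \<omega>) x \<omega> \<in> E \<longrightarrow> \<omega> x \<noteq> c"
  have off: "off_site (\<lambda>\<omega>. \<omega>) x \<in> measurable (config_space UNIV) (config_space (- {x}))"
    by (rule measurable_off_site) simp
  have inE [measurable]: "Measurable.pred (config_space UNIV) (\<lambda>\<omega>. off_site (\<lambda>\<omega>. \<omega>) x \<omega> \<in> E)"
    using off E by measurable
  have [measurable]: "Measurable.pred (config_space UNIV) (\<lambda>\<omega>. \<omega> x)"
    by (rule measurable_config_component) simp
  have "Measurable.pred (config_space UNIV) (\<lambda>\<omega>. off_site (\<lambda>\<omega>. \<omega>) x \<omega> \<in> E \<longrightarrow> \<omega> x \<noteq> c)"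
    by measurable
  with avoid have "AE l in geo_field. AE n in geo_field.
      off_site (\<lambda>\<omega>. \<omega>) x (woven (l, n)) \<in> E \<longrightarrow> woven (l, n) x \<noteq> c"
    by (simp add: AE_woven_law_iff)
  then have "AE l in geo_field. AE n in geo_field. off_site (\<lambda>\<omega>. \<omega>) x (woven (l, n)) \<notin> E"
  proof eventually_elim
    case (elim l)
    from AE_geo_field_resample[OF this, of x] show ?case
    proof eventually_elim
      case (elim n)
      obtain u where "woven (l, n(x := u)) x = c" using woven_resample_attains by blast
      with elim[rule_format, of u] show ?case unfolding off_site_woven_resample by blast
    qed
  qed
  moreover have "Measurable.pred (config_space UNIV) (\<lambda>\<omega>. off_site (\<lambda>\<omega>. \<omega>) x \<omega> \<notin> E)"
    by measurable
  ultimately show "AE \<omega> in woven_law. off_site (\<lambda>\<omega>. \<omega>) x \<omega> \<notin> E"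
    by (simp add: AE_woven_law_iff)
qed

text \<open>Translating the configuration amounts to permuting the independent and identically distributed labels
  and noise variables.\<close>

definition translate ::
  "site \<Rightarrow> (int + int \<Rightarrow> nat) \<times> (site \<Rightarrow> nat) \<Rightarrow> (int + int \<Rightarrow> nat) \<times> (site \<Rightarrow> nat)" where
  "translate y = (\<lambda>(l, n). (l \<circ> map_sum (\<lambda>i. i + fst y) (\<lambda>j. j + snd y), n \<circ> (\<lambda>v. v + y)))"

lemma colour_depth_translate:
  fixes a b :: "int \<Rightarrow> nat"
  shows "colour (\<lambda>i. a (i + fst y)) (\<lambda>j. b (j + snd y)) v = colour a b (v + y)"
    "depth (\<lambda>i. a (i + fst y)) (\<lambda>j. b (j + snd y)) v = depth a b (v + y)"
proof -
  have line: "line_level (\<lambda>i. a (i + t)) i = line_level a (i + t)"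
    "line_open (\<lambda>i. a (i + t)) i = line_open a (i + t)" for a :: "int \<Rightarrow> nat" and i t
    by (simp_all add: line_level_def line_open_def algebra_simps)
  show col: "colour (\<lambda>i. a (i + fst y)) (\<lambda>j. b (j + snd y)) v = colour a b (v + y)"
    by (simp add: colour_def column_on_top_def line)
  have "surpassed_within (\<lambda>i. a (i + fst y)) (\<lambda>j. b (j + snd y)) v = surpassed_within a b (v + y)"
    by (simp add: fun_eq_iff surpassed_within_def direction_def level_def col line algebra_simps)
  then show "depth (\<lambda>i. a (i + fst y)) (\<lambda>j. b (j + snd y)) v = depth a b (v + y)"
    by (simp add: depth_def)
qed

lemma woven_translate: "woven (translate y \<omega>) v = woven \<omega> (v + y)"
  using colour_depth_translate[of "fst \<omega> \<circ> Inl" y "fst \<omega> \<circ> Inr" v]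
  by (simp add: woven_def translate_def case_prod_beta comp_def)

lemma distr_translate: 
  "translate y \<in> measurable woven_space woven_space" "distr woven_space woven_space (translate y) = woven_space"
proof -
  let ?f = "map_sum (\<lambda>i. i + fst y) (\<lambda>j. j + snd y)" and ?g = "\<lambda>v. v + y"
  have reindex: "(\<lambda>l. l \<circ> f) \<in> measurable geo_field geo_field" for f
    by (rule measurable_geo_fieldI) (simp add: comp_def measurable_geo_field_component)
  have inj: "inj ?f" "inj ?g"
    by (rule sum.inj_map) (simp_all add: inj_def)
  interpret B: prob_space "geo_field :: (site \<Rightarrow> nat) measure" by (rule prob_space_geo_field)
  have "distr geo_field geo_field (\<lambda>l. l \<circ> ?f) \<Otimes>\<^sub>M distr geo_field geo_field (\<lambda>n. n \<circ> ?g) =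
      distr woven_space woven_space (translate y)"
    unfolding translate_def
    by (rule pair_measure_distr[OF reindex reindex])
      (simp add: distr_geo_field_reindex[OF inj(2)] B.sigma_finite_measure_axioms)
  then show "distr woven_space woven_space (translate y) = woven_space"
    by (simp add: distr_geo_field_reindex inj)
  show "translate y \<in> measurable woven_space woven_space"
    unfolding translate_def case_prod_beta
    by (intro measurable_Pair measurable_compose[OF measurable_fst reindex]
        measurable_compose[OF measurable_snd reindex])
qed

lemma translation_invariant_woven_law: "translation_invariant woven_law (\<lambda>\<omega>. \<omega>)"
proof -
  have "distr woven_law (PiM {1..n} (\<lambda>_. count_space UNIV)) (\<lambda>\<omega>. \<lambda>i\<in>{1..n}. \<omega> (x i + y)) =
      distr woven_space (PiM {1..n} (\<lambda>_. count_space UNIV)) (\<lambda>\<omega>. \<lambda>i\<in>{1..n}. woven \<omega> (x i))"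
    for n :: nat and x y
  proof -
    let ?P = "PiM {1..n} (\<lambda>_. count_space (UNIV :: bool set))"
    have sample: "(\<lambda>\<omega>. \<lambda>i\<in>{1..n}. \<omega> (z i)) \<in> measurable (config_space UNIV) ?P" for z :: "nat \<Rightarrow> site"
      by (intro measurable_restrict measurable_config_component) simp
    have "distr woven_law ?P (\<lambda>\<omega>. \<lambda>i\<in>{1..n}. \<omega> (x i + y)) =
        distr woven_space ?P (\<lambda>\<omega>. \<lambda>i\<in>{1..n}. woven \<omega> (x i + y))"
      unfolding woven_law_def distr_distr[OF sample measurable_woven] comp_def ..
    also have "\<dots> = distr woven_space ?P ((\<lambda>\<omega>. \<lambda>i\<in>{1..n}. woven \<omega> (x i)) \<circ> translate y)"
      by (simp add: comp_def woven_translate)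
    also have "\<dots> = distr (distr woven_space woven_space (translate y)) ?P (\<lambda>\<omega>. \<lambda>i\<in>{1..n}. woven \<omega> (x i))"
      by (rule distr_distr[symmetric, OF measurable_compose[OF measurable_woven sample] distr_translate(1)])
    finally show ?thesis unfolding distr_translate(2) .
  qed
  then show ?thesis unfolding translation_invariant_def by simp
qed

theorem proposition2p1:
  "\<exists>(M :: config measure) (X :: config \<Rightarrow> config).
     site_percolation M X \<and>
     translation_invariant M X \<and>
     finite_energy M X \<and>
     (AE \<omega> in M. (\<exists>C. open_cluster (X \<omega>) C \<and> infinite C) \<and>
                  (\<exists>C. closed_cluster (X \<omega>) C \<and> infinite C))"
proof (intro exI conjI)
  show "site_percolation woven_law (\<lambda>\<omega>. \<omega>)" by (rule site_percolation_woven_law)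
  show "translation_invariant woven_law (\<lambda>\<omega>. \<omega>)" by (rule translation_invariant_woven_law)
  show "finite_energy woven_law (\<lambda>\<omega>. \<omega>)" by (rule finite_energy_woven_law)
  show "AE \<omega> in woven_law. (\<exists>C. open_cluster \<omega> C \<and> infinite C) \<and> (\<exists>C. closed_cluster \<omega> C \<and> infinite C)"
    using AE_woven_law_percolates[of True] AE_woven_law_percolates[of False]
    by eventually_elim (intro conjI infinite_clusters_if_percolates)
qed

end
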